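(* There is no partial computable function $f$ such that, whenever $e$ is an index for a computable $2$-coloring $c:[\mathbb{N}]^2\to\{\text{BLUE},\text{RED}\}$, $f(e)$ is (defined and is) an index for a $\Delta^0_2$ path decomposition for $c$.
   Context: A (monochromatic) path of color $k$ is a finite or infinite list of distinct natural numbers in which every two consecutive elements form a pair of color $k$ (empty and one-element lists are paths of every color). An index for a computable coloring $c$ is a number $e$ such that $\varphi_e$ computes $c$. A $\Delta^0_2$ path decomposition for $c$ is a pair $(P_b,P_r)$ of partial $\emptyset'$-computable functions whose domains are initial segments of $\mathbb{N}$, whose ranges partition $\mathbb{N}$, such that $c(\{P_b(n),P_b(n+1)\})$ is BLUE whenever $n+1\in\mathrm{dom}(P_b)$ and $c(\{P_r(n),P_r(n+1)\})$ is RED whenever $n+1\in\mathrm{dom}(P_r)$. An index for such a decomposition is (a code for) a pair $(i_b,i_r)$ with $\Phi_{i_b}^{\emptyset'}=P_b$ and $\Phi_{i_r}^{\emptyset'}=P_r$. *)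

theory Defs
  imports Main "HOL-Library.Nat_Bijection"
begin

text \<open>
  Programs for the unary partial functions on \<open>nat\<close> that are partial recursive in a set \<open>A\<close>.
  Several arguments are passed as one number through \<^const>\<open>prod_encode\<close>.  The identity function
  is computed by \<open>Pairing Fst Snd\<close>, and \<open>Query\<close> computes the characteristic function of \<open>A\<close>.
\<close>

datatype prog =
    Zero | Succ | Fst | Snd | Query
  | Pairing prog prog | Comp prog prog | PrimRec prog prog | Mu prog

abbreviation npair :: "nat \<Rightarrow> nat \<Rightarrow> nat" where
  "npair x y \<equiv> prod_encode (x, y)"

primrec run :: "nat set \<Rightarrow> prog \<Rightarrow> nat \<Rightarrow> nat option" where
  "run A Zero = (\<lambda>x. Some 0)"
| "run A Succ = (\<lambda>x. Some (Suc x))"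
| "run A Fst = (\<lambda>x. Some (fst (prod_decode x)))"
| "run A Snd = (\<lambda>x. Some (snd (prod_decode x)))"
| "run A Query = (\<lambda>x. Some (if x \<in> A then 1 else 0))"
| "run A (Pairing f g) = (\<lambda>x. Option.bind (run A f x) (\<lambda>u.
     Option.bind (run A g x) (\<lambda>v. Some (npair u v))))"
| "run A (Comp f g) = (\<lambda>x. Option.bind (run A g x) (run A f))"
| "run A (PrimRec f g) = (\<lambda>z. case prod_decode z of (x, n) \<Rightarrow>
     rec_nat (run A f x)
       (\<lambda>k r. Option.bind r (\<lambda>u. run A g (npair x (npair k u)))) n)"
| "run A (Mu f) = (\<lambda>x.
     let hit = (\<lambda>n. run A f (npair x n) = Some 0 \<and>
                    (\<forall>m<n. \<exists>v>0. run A f (npair x m) = Some v))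
     in if \<exists>n. hit n then Some (LEAST n. hit n) else None)"

primrec prog_encode :: "prog \<Rightarrow> nat" where
  "prog_encode Zero = 0"
| "prog_encode Succ = 1"
| "prog_encode Fst = 2"
| "prog_encode Snd = 3"
| "prog_encode Query = 4"
| "prog_encode (Pairing f g) = 5 + 4 * npair (prog_encode f) (prog_encode g)"
| "prog_encode (Comp f g) = 6 + 4 * npair (prog_encode f) (prog_encode g)"
| "prog_encode (PrimRec f g) = 7 + 4 * npair (prog_encode f) (prog_encode g)"
| "prog_encode (Mu f) = 8 + 4 * prog_encode f"

lemma inj_prog_encode: "inj prog_encode"
proof -
  have "prog_encode p = prog_encode q \<Longrightarrow> p = q" for p q
  proof (induction p arbitrary: q)
    case (Pairing f g) then show ?case by (cases q) (simp_all, presburger+)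
  next
    case (Comp f g) then show ?case by (cases q) (simp_all, presburger+)
  next
    case (PrimRec f g) then show ?case by (cases q) (simp_all, presburger+)
  next
    case (Mu f) then show ?case by (cases q) (simp_all, presburger+)
  qed (case_tac q; simp)+
  then show ?thesis by (rule injI)
qed

lemma surj_prog_encode: "surj prog_encode"
proof -
  have "\<exists>p. prog_encode p = n" for n
  proof (induction n rule: less_induct)
    case (less n)
    show ?case
    proof (cases "n < 5")
      case True
      then have "n = 0 \<or> n = 1 \<or> n = 2 \<or> n = 3 \<or> n = 4" by presburger
      then show ?thesis by (metis prog_encode.simps(1-5))
    next
      case False
      define m where "m = (n - 5) div 4"
      have n: "n = 5 + 4 * m \<or> n = 6 + 4 * m \<or> n = 7 + 4 * m \<or> n = 8 + 4 * m"
        and mn: "m < n"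
        using False unfolding m_def by presburger+
      obtain a b where ab: "m = npair a b"
        by (metis prod.collapse prod_decode_inverse)
      have "a < n" "b < n"
        using mn le_prod_encode_1[of a b] le_prod_encode_2[of b a] ab by simp_all
      then obtain p q r where "prog_encode p = a" "prog_encode q = b" "prog_encode r = m"
        using less mn by meson
      then show ?thesis
        using n ab by (metis prog_encode.simps(6-9))
    qed
  qed
  then show ?thesis by (metis surjI)
qed

text \<open>By the two lemmas above, every number codes exactly one program.\<close>

definition prog_decode :: "nat \<Rightarrow> prog" where
  "prog_decode = inv prog_encode"

definition \<Phi> :: "nat set \<Rightarrow> nat \<Rightarrow> nat \<Rightarrow> nat option" where
  "\<Phi> A e = run A (prog_decode e)"

definition \<phi> :: "nat \<Rightarrow> nat \<Rightarrow> nat option" where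
  "\<phi> = \<Phi> {}"

definition partial_computable_in :: "nat set \<Rightarrow> (nat \<Rightarrow> nat option) \<Rightarrow> bool" where
  "partial_computable_in A g \<longleftrightarrow> (\<exists>e. \<Phi> A e = g)"

definition partial_computable :: "(nat \<Rightarrow> nat option) \<Rightarrow> bool" where
  "partial_computable g \<longleftrightarrow> (\<exists>e. \<phi> e = g)"

definition halting_set :: "nat set" where
  "halting_set = {e. e \<in> dom (\<phi> e)}"

datatype color = BLUE | RED

primrec color_code :: "color \<Rightarrow> nat" where
  "color_code BLUE = 0"
| "color_code RED = 1"

text \<open>
  A coloring of \<open>[nat]\<^sup>2\<close> is a function on \<open>nat set\<close> of which only the values on two-element
  sets matter.  As an input to a program, the set \<open>{x, y}\<close> with \<open>x < y\<close> is coded as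
  \<open>npair x y\<close>.
\<close>

type_synonym coloring = "nat set \<Rightarrow> color"

definition coloring_index :: "nat \<Rightarrow> coloring \<Rightarrow> bool" where
  "coloring_index e c \<longleftrightarrow> (\<forall>x y. x < y \<longrightarrow> \<phi> e (npair x y) = Some (color_code (c {x, y})))"

definition computable_coloring :: "coloring \<Rightarrow> bool" where
  "computable_coloring c \<longleftrightarrow> (\<exists>e. coloring_index e c)"

definition initial_segment :: "nat set \<Rightarrow> bool" where
  "initial_segment D \<longleftrightarrow> (\<forall>n\<in>D. \<forall>m<n. m \<in> D)"

text \<open>A finite or infinite list is a partial function whose domain is an initial segment.\<close>

definition mono_path :: "coloring \<Rightarrow> color \<Rightarrow> (nat \<Rightarrow> nat option) \<Rightarrow> bool" where
  "mono_path c k P \<longleftrightarrow>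
     initial_segment (dom P) \<and> inj_on P (dom P) \<and>
     (\<forall>n. Suc n \<in> dom P \<longrightarrow> c {the (P n), the (P (Suc n))} = k)"

definition delta2_path_decomposition ::
    "coloring \<Rightarrow> (nat \<Rightarrow> nat option) \<times> (nat \<Rightarrow> nat option) \<Rightarrow> bool" where
  "delta2_path_decomposition c = (\<lambda>(Pb, Pr).
     partial_computable_in halting_set Pb \<and> partial_computable_in halting_set Pr \<and>
     mono_path c BLUE Pb \<and> mono_path c RED Pr \<and>
     ran Pb \<inter> ran Pr = {} \<and> ran Pb \<union> ran Pr = UNIV)"

definition decomposition_index ::
    "nat \<Rightarrow> (nat \<Rightarrow> nat option) \<times> (nat \<Rightarrow> nat option) \<Rightarrow> bool" where
  "decomposition_index d = (\<lambda>(Pb, Pr). \<exists>ib ir.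
     d = npair ib ir \<and> \<Phi> halting_set ib = Pb \<and> \<Phi> halting_set ir = Pr)"

end

theory Submission
  imports Defs
begin

text \<open>
  That \<open>0\<close> lies on the blue (red) path with index \<open>f e\<close> is a \<open>\<Sigma>\<^sub>2\<close> fact: it
  has a finite certificate \<open>w\<close> whose negative oracle answers survive all stages.  At stage \<open>s\<close>
  let \<open>chosen s\<close> be the least \<open>w\<close> not refuted so far.  By the recursion theorem there is an
  index \<open>e\<close> of the coloring in which, for \<open>z < s\<close>, the pair \<open>{z, s}\<close> has color \<open>K\<close> if
  \<open>chosen z = chosen s\<close> and the other color \<open>L\<close> if not, where \<open>K\<close> is the color of the path on
  which \<open>chosen s\<close> places \<open>0\<close>.

  As \<open>0\<close> is on one of the paths, \<open>chosen\<close> converges to a correct certificate \<open>w\<close>.  The set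
  \<open>F = {s. chosen s = w}\<close> is cofinite and omits \<open>0\<close>; pairs inside \<open>F\<close> have color \<open>K\<close>, and pairs
  between \<open>F\<close> and its complement have color \<open>L\<close>.  So the \<open>K\<close>-path, which contains \<open>0\<close>, avoids
  \<open>F\<close>, and the \<open>L\<close>-path must cover \<open>F\<close>; but it has to leave \<open>F\<close> after each step, into a finite set.
\<close>

section \<open>Recursive functions and predicates\<close>

abbreviation pfst :: "nat \<Rightarrow> nat" where "pfst n \<equiv> fst (prod_decode n)"
abbreviation psnd :: "nat \<Rightarrow> nat" where "psnd n \<equiv> snd (prod_decode n)"

definition recursive_fun :: "(nat \<Rightarrow> nat) \<Rightarrow> bool" where
  "recursive_fun f \<longleftrightarrow> (\<exists>p. \<forall>x. run {} p x = Some (f x))"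

definition recursive_pred :: "(nat \<Rightarrow> bool) \<Rightarrow> bool" where
  "recursive_pred P \<longleftrightarrow> recursive_fun (\<lambda>x. of_bool (P x))"

named_theorems recursive_intros

lemma recursive_fun_id [recursive_intros]: "recursive_fun (\<lambda>x. x)"
  unfolding recursive_fun_def by (rule exI[of _ "Pairing Fst Snd"]) simp

lemma recursive_fun_comp:
  assumes "recursive_fun f" "recursive_fun g"
  shows "recursive_fun (\<lambda>x. f (g x))"
proof -
  from assms obtain p q where "\<And>x. run {} p x = Some (f x)" "\<And>x. run {} q x = Some (g x)"
    unfolding recursive_fun_def by metis
  then show ?thesis
    unfolding recursive_fun_def by (intro exI[of _ "Comp p q"]) simp
qed

lemma recursive_fun_Suc [recursive_intros]:
  assumes "recursive_fun f"
  shows "recursive_fun (\<lambda>x. Suc (f x))"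
proof -
  have "recursive_fun Suc"
    unfolding recursive_fun_def by (rule exI[of _ Succ]) simp
  then show ?thesis using assms by (rule recursive_fun_comp)
qed

lemma recursive_fun_const [recursive_intros]: "recursive_fun (\<lambda>_. c)"
proof (induction c)
  case 0
  show ?case unfolding recursive_fun_def by (rule exI[of _ Zero]) simp
qed (rule recursive_fun_Suc)

lemma recursive_fun_pfst [recursive_intros]:
  assumes "recursive_fun f"
  shows "recursive_fun (\<lambda>x. pfst (f x))"
proof -
  have "recursive_fun pfst"
    unfolding recursive_fun_def by (rule exI[of _ Fst]) simp
  then show ?thesis using assms by (rule recursive_fun_comp)
qed

lemma recursive_fun_psnd [recursive_intros]:
  assumes "recursive_fun f"
  shows "recursive_fun (\<lambda>x. psnd (f x))"
proof -
  have "recursive_fun psnd"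
    unfolding recursive_fun_def by (rule exI[of _ Snd]) simp
  then show ?thesis using assms by (rule recursive_fun_comp)
qed

lemma recursive_fun_npair [recursive_intros]:
  assumes "recursive_fun f" "recursive_fun g"
  shows "recursive_fun (\<lambda>x. npair (f x) (g x))"
proof -
  from assms obtain p q where "\<And>x. run {} p x = Some (f x)" "\<And>x. run {} q x = Some (g x)"
    unfolding recursive_fun_def by metis
  then show ?thesis
    unfolding recursive_fun_def by (intro exI[of _ "Pairing p q"]) simp
qed

text \<open>\<open>PrimRec\<close> carries the parameter \<open>x\<close> along unchanged, so the
  step may depend on it. Arithmetic, case distinctions and bounded search are obtained below by
  rewriting them as \<open>rec_nat\<close>.\<close>

lemma recursive_fun_rec_nat [recursive_intros]:
  assumes "recursive_fun a"
    and "recursive_fun (\<lambda>z. g (pfst z) (pfst (psnd z)) (psnd (psnd z)))"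
    and "recursive_fun n"
  shows "recursive_fun (\<lambda>x. rec_nat (a x) (g x) (n x))"
proof -
  obtain p q where p: "\<And>x. run {} p x = Some (a x)"
    and q: "\<And>z. run {} q z = Some (g (pfst z) (pfst (psnd z)) (psnd (psnd z)))"
    using assms(1,2) unfolding recursive_fun_def by metis
  have "rec_nat (Some (a x)) (\<lambda>k r. Option.bind r (\<lambda>u. run {} q (npair x (npair k u)))) m
      = Some (rec_nat (a x) (g x) m)" for x m
    by (induction m) (simp_all add: q)
  then have "recursive_fun (\<lambda>z. rec_nat (a (pfst z)) (g (pfst z)) (psnd z))"
    unfolding recursive_fun_def
    by (intro exI[of _ "PrimRec p q"]) (simp add: p split: prod.split)
  from recursive_fun_comp[OF this recursive_fun_npair[OF recursive_fun_id assms(3)]]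
  show ?thesis by simp
qed

lemma recursive_fun_add [recursive_intros]:
  assumes "recursive_fun f" "recursive_fun g"
  shows "recursive_fun (\<lambda>x. f x + g x)"
proof -
  have "a + b = rec_nat a (\<lambda>_. Suc) b" for a b :: nat
    by (induction b) simp_all
  then show ?thesis by (simp only:) (intro recursive_intros assms)
qed

lemma recursive_fun_mult [recursive_intros]:
  assumes "recursive_fun f" "recursive_fun g"
  shows "recursive_fun (\<lambda>x. f x * g x)"
proof -
  have *: "a * b = rec_nat 0 (\<lambda>_ r. r + a) b" for a b :: nat
    by (induction b) simp_all
  show ?thesis unfolding *
    by (intro recursive_intros recursive_fun_comp[OF assms(1)] assms)
qed

lemma recursive_fun_power2 [recursive_intros]:
  assumes "recursive_fun f"
  shows "recursive_fun (\<lambda>x. 2 ^ f x)"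
proof -
  have *: "(2::nat) ^ b = rec_nat 1 (\<lambda>_ r. r + r) b" for b :: nat
    by (induction b) simp_all
  show ?thesis unfolding * by (intro recursive_intros assms)
qed

lemma recursive_fun_diff [recursive_intros]:
  assumes "recursive_fun f" "recursive_fun g"
  shows "recursive_fun (\<lambda>x. f x - g x)"
proof -
  have pred: "b - Suc 0 = rec_nat 0 (\<lambda>k _. k) b" for b :: nat
    by (cases b) simp_all
  have *: "a - b = rec_nat a (\<lambda>_ r. rec_nat 0 (\<lambda>k _. k) r) b" for a b :: nat
    by (induction b) (simp_all flip: pred)
  show ?thesis unfolding * by (intro recursive_intros assms)
qed

section \<open>Recursive predicates and bounded quantifiers\<close>

lemma recursive_fun_If:
  assumes "recursive_pred P" "recursive_fun f" "recursive_fun g"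
  shows "recursive_fun (\<lambda>x. if P x then f x else g x)"
proof -
  have *: "(if Q then a else b) = rec_nat b (\<lambda>_ _. a) (of_bool Q)" for Q and a b :: nat
    by simp
  show ?thesis unfolding *
    by (intro recursive_intros recursive_fun_comp[OF assms(2)] assms(1)[unfolded recursive_pred_def] assms)
qed

lemma recursive_pred_comp:
  assumes "recursive_pred P" "recursive_fun g"
  shows "recursive_pred (\<lambda>x. P (g x))"
  using recursive_fun_comp[of "\<lambda>x. of_bool (P x)" g] assms unfolding recursive_pred_def by simp

lemma recursive_pred_not [recursive_intros]:
  assumes "recursive_pred P"
  shows "recursive_pred (\<lambda>x. \<not> P x)"
proof -
  have "recursive_fun (\<lambda>x. if P x then 0 else 1)"
    by (intro recursive_fun_If recursive_intros assms)
  then show ?thesis unfolding recursive_pred_def by (rule back_subst[of recursive_fun]) auto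
qed

lemma recursive_pred_conj [recursive_intros]:
  assumes "recursive_pred P" "recursive_pred Q"
  shows "recursive_pred (\<lambda>x. P x \<and> Q x)"
proof -
  have "recursive_fun (\<lambda>x. if P x then of_bool (Q x) else 0)"
    by (intro recursive_fun_If recursive_intros assms assms(2)[unfolded recursive_pred_def])
  then show ?thesis unfolding recursive_pred_def by (rule back_subst[of recursive_fun]) auto
qed

lemma recursive_pred_disj [recursive_intros]:
  assumes "recursive_pred P" "recursive_pred Q"
  shows "recursive_pred (\<lambda>x. P x \<or> Q x)"
proof -
  have "recursive_pred (\<lambda>x. \<not> (\<not> P x \<and> \<not> Q x))"
    by (intro recursive_intros assms)
  then show ?thesis by simp
qed

lemma recursive_pred_imp [recursive_intros]:
  assumes "recursive_pred P" "recursive_pred Q"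
  shows "recursive_pred (\<lambda>x. P x \<longrightarrow> Q x)"
  unfolding imp_conv_disj by (intro recursive_intros assms)

lemma recursive_pred_iff:
  assumes "recursive_pred P" "recursive_pred Q"
  shows "recursive_pred (\<lambda>x. P x \<longleftrightarrow> Q x)"
  unfolding iff_conv_conj_imp by (intro recursive_intros assms)

lemma recursive_pred_less [recursive_intros]:
  assumes "recursive_fun f" "recursive_fun g"
  shows "recursive_pred (\<lambda>x. f x < g x)"
proof -
  have *: "of_bool (a < b) = rec_nat (0::nat) (\<lambda>_ _. 1) (b - a)" for a b :: nat
    by (cases "b - a") auto
  show ?thesis unfolding recursive_pred_def * by (intro recursive_intros assms)
qed

lemma recursive_pred_le [recursive_intros]:
  assumes "recursive_fun f" "recursive_fun g"
  shows "recursive_pred (\<lambda>x. f x \<le> g x)"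
  unfolding not_less[symmetric] by (intro recursive_intros assms)

lemma recursive_pred_eq [recursive_intros]:
  assumes "recursive_fun f" "recursive_fun g"
  shows "recursive_pred (\<lambda>x. f x = g x)"
  unfolding order.eq_iff[where 'a = nat] by (intro recursive_intros assms)

lemma recursive_pred_Ex_less [recursive_intros]:
  assumes "recursive_pred (\<lambda>z. Q (pfst z) (psnd z))" "recursive_fun n"
  shows "recursive_pred (\<lambda>x. \<exists>i<n x. Q x i)"
proof -
  have step: "(\<exists>i<Suc b. R i) = (if R b then True else \<exists>i<b. R i)" for R and b :: nat
    by (auto simp: less_Suc_eq)
  have *: "of_bool (\<exists>i<b. R i) = rec_nat (0::nat) (\<lambda>k r. if R k then 1 else r) b" for R and b :: nat
    by (induction b) (simp_all add: step del: One_nat_def)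
  \<comment> \<open>The recursion step receives the parameter, the counter and the previous value;
    \<open>Q\<close> must look at the first two only.\<close>
  have "recursive_pred (\<lambda>z. Q (pfst z) (pfst (psnd z)))"
    using recursive_pred_comp[OF assms(1), of "\<lambda>z. npair (pfst z) (pfst (psnd z))"]
    by (simp add: recursive_intros)
  then show ?thesis unfolding recursive_pred_def[of "\<lambda>x. \<exists>i<n x. Q x i"] *
    by (intro recursive_intros recursive_fun_If assms)
qed

lemma recursive_pred_All_less [recursive_intros]:
  assumes "recursive_pred (\<lambda>z. Q (pfst z) (psnd z))" "recursive_fun n"
  shows "recursive_pred (\<lambda>x. \<forall>i<n x. Q x i)"
proof -
  have "recursive_pred (\<lambda>x. \<not> (\<exists>i<n x. \<not> Q x i))"
    by (intro recursive_intros assms)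
  then show ?thesis by simp
qed

section \<open>Finite sets coded by binary digits\<close>

lemma less_of_mem_set_decode: "k \<in> set_decode w \<Longrightarrow> k < w"
proof -
  assume "k \<in> set_decode w"
  then have "w div 2 ^ k \<noteq> 0" by (auto simp: set_decode_def dest: odd_pos)
  then have "2 ^ k \<le> w" by (metis div_less not_le)
  then show ?thesis using less_exp[of k] by linarith
qed

text \<open>Bit \<open>k\<close> of \<open>w\<close> is the parity of \<open>w div 2 ^ k\<close>.
  Guessing the odd quotient and the remainder expresses this by bounded search over sums, products
  and powers of two, all known to be recursive.\<close>

lemma mem_set_decode_iff:
  "k \<in> set_decode w \<longleftrightarrow> (\<exists>q<Suc w. \<exists>r<2 ^ k. w = 2 ^ k * (q + q + 1) + r)"
proof
  assume "k \<in> set_decode w"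
  then have "odd (w div 2 ^ k)" by (simp add: set_decode_def)
  then obtain q where q: "w div 2 ^ k = q + q + 1" by (metis mult_2 oddE)
  have w: "w = 2 ^ k * (q + q + 1) + w mod 2 ^ k" by (metis mult_div_mod_eq q)
  have "q \<le> w div 2 ^ k" using q by simp
  also have "\<dots> \<le> w" by simp
  finally have "q < Suc w" by simp
  moreover have "w mod 2 ^ k < 2 ^ k" by simp
  ultimately show "\<exists>q<Suc w. \<exists>r<2 ^ k. w = 2 ^ k * (q + q + 1) + r" using w by blast
next
  assume "\<exists>q<Suc w. \<exists>r<2 ^ k. w = 2 ^ k * (q + q + 1) + r"
  then obtain q r where "r < 2 ^ k" "w = r + (q + q + 1) * 2 ^ k"
    by (auto simp: algebra_simps)
  then have "w div 2 ^ k = q + q + 1"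
    by (metis add_0 div_less div_mult_self1 power_not_zero zero_neq_numeral add.commute)
  then show "k \<in> set_decode w" by (simp add: set_decode_def)
qed

lemma recursive_pred_mem_set_decode [recursive_intros]:
  assumes "recursive_fun f" "recursive_fun g"
  shows "recursive_pred (\<lambda>x. f x \<in> set_decode (g x))"
  unfolding mem_set_decode_iff
  by (intro recursive_intros recursive_fun_comp[OF assms(1)] recursive_fun_comp[OF assms(2)] assms)

section \<open>The recursion theorem\<close>

primrec const_prog :: "nat \<Rightarrow> prog" where
  "const_prog 0 = Zero"
| "const_prog (Suc n) = Comp Succ (const_prog n)"

lemma run_const_prog [simp]: "run A (const_prog n) x = Some n"
  by (induction n) simp_all

lemma prog_encode_decode [simp]: "prog_encode (prog_decode n) = n"
  unfolding prog_decode_def by (simp add: surj_prog_encode surj_f_inv_f)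

lemma prog_decode_encode [simp]: "prog_decode (prog_encode p) = p"
  unfolding prog_decode_def by (simp add: inj_prog_encode)

text \<open>
  With \<open>y\<close> the code of \<open>\<lambda>(y, x). g (self_apply y, x)\<close>, the number \<open>self_apply y\<close> is a fixed
  point; a universal program is not needed.
\<close>

definition self_apply :: "nat \<Rightarrow> nat" where
  "self_apply y =
     prog_encode (Comp (prog_decode y) (Pairing (const_prog y) (Pairing Fst Snd)))"

text \<open>No decoding has to be computed: \<open>y\<close> itself reappears as the code of
  \<open>prog_decode y\<close>. The code of a constant program arises by iterating composition with
  \<open>Succ\<close>, whose code is 1.\<close>

lemma recursive_fun_self_apply: "recursive_fun self_apply"
proof -
  have "prog_encode (const_prog n) = rec_nat 0 (\<lambda>_ r. 6 + 4 * npair 1 r) n" for n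
    by (induction n) simp_all
  then have *: "self_apply = (\<lambda>y. 6 + 4 * npair y (5 + 4 * npair
      (rec_nat 0 (\<lambda>_ r. 6 + 4 * npair 1 r) y) (prog_encode (Pairing Fst Snd))))"
    by (simp add: fun_eq_iff self_apply_def)
  show ?thesis unfolding * by (intro recursive_intros)
qed

lemma recursion_theorem:
  assumes "recursive_fun g"
  shows "\<exists>e. \<forall>x. \<phi> e x = Some (g (npair e x))"
proof -
  have "recursive_fun (\<lambda>z. g (npair (self_apply (pfst z)) (psnd z)))"
    by (intro recursive_fun_comp[OF assms] recursive_fun_comp[OF recursive_fun_self_apply]
        recursive_intros)
  then obtain q where
    q: "\<And>z. run {} q z = Some (g (npair (self_apply (pfst z)) (psnd z)))"
    unfolding recursive_fun_def by blast
  let ?e = "self_apply (prog_encode q)"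
  have "prog_decode ?e = Comp q (Pairing (const_prog (prog_encode q)) (Pairing Fst Snd))"
    by (simp only: self_apply_def prog_decode_encode)
  then have "\<phi> ?e x = Some (g (npair ?e x))" for x
    by (simp add: \<phi>_def \<Phi>_def q)
  then show ?thesis by blast
qed

section \<open>Certificates of computations\<close>

text \<open>
  A claim says that the program with code \<open>c\<close> maps \<open>x\<close> to \<open>v\<close>.
  The mode \<open>m\<close> selects the oracle: the halting set for \<open>m = 1\<close>, the empty set otherwise.
\<close>

definition query_set :: "nat \<Rightarrow> nat set" where
  "query_set m = (if m = 1 then halting_set else {})"

definition claim :: "nat \<Rightarrow> nat \<Rightarrow> nat \<Rightarrow> nat \<Rightarrow> nat" where
  "claim m c x v = npair m (npair c (npair x v))"

lemma claim_eq_iff [simp]: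
  "claim m c x v = claim m' c' x' v' \<longleftrightarrow> m = m' \<and> c = c' \<and> x = x' \<and> v = v'"
  by (simp add: claim_def)

lemma claim_ge: "m \<le> claim m c x v" "c \<le> claim m c x v" "x \<le> claim m c x v" "v \<le> claim m c x v"
  unfolding claim_def
  by (meson le_prod_encode_1 le_prod_encode_2 order_trans)+

lemma claim_less:
  assumes "claim m c x v \<in> set_decode w"
  shows "m < w" "c < w" "x < w" "v < w"
  using less_of_mem_set_decode[OF assms] claim_ge[where m = m and c = c and x = x and v = v]
  by (meson le_less_trans)+

lemma recursive_fun_claim [recursive_intros]:
  assumes "recursive_fun m" "recursive_fun c" "recursive_fun x" "recursive_fun v"
  shows "recursive_fun (\<lambda>z. claim (m z) (c z) (x z) (v z))"
  unfolding claim_def by (intro recursive_intros assms)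

text \<open>
  One unfolding step of \<^const>\<open>run\<close>, with the negative oracle answers of mode \<open>1\<close> left unchecked.
  Every claim refers to claims about smaller programs, smaller recursion arguments or a smaller
  mode only, so circular justifications cannot occur.
\<close>

definition justified :: "nat set \<Rightarrow> nat \<Rightarrow> nat \<Rightarrow> nat \<Rightarrow> nat \<Rightarrow> bool" where
  "justified M m c x v \<longleftrightarrow>
     c = 0 \<and> v = 0 \<or> c = 1 \<and> v = Suc x \<or> c = 2 \<and> v = pfst x \<or> c = 3 \<and> v = psnd x \<or>
     c = 4 \<and> (v = 0 \<or> v = 1 \<and> m = 1 \<and> (\<exists>u. claim 0 x x u \<in> M)) \<or>
     (\<exists>f g. c = 5 + 4 * npair f g \<and> claim m f x (pfst v) \<in> M \<and> claim m g x (psnd v) \<in> M) \<or>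
     (\<exists>f g. c = 6 + 4 * npair f g \<and> (\<exists>u. claim m g x u \<in> M \<and> claim m f u v \<in> M)) \<or>
     (\<exists>f g. c = 7 + 4 * npair f g \<and>
        (psnd x = 0 \<and> claim m f (pfst x) v \<in> M \<or>
         (\<exists>k u. psnd x = Suc k \<and> claim m c (npair (pfst x) k) u \<in> M \<and>
           claim m g (npair (pfst x) (npair k u)) v \<in> M))) \<or>
     (\<exists>f. c = 8 + 4 * f \<and> claim m f (npair x v) 0 \<in> M \<and>
        (\<forall>y<v. \<exists>u. claim m f (npair x y) (Suc u) \<in> M))"

text \<open>\<open>M\<close> occurs only positively. This is what allows certificates to be united
  and extended.\<close>

lemma justified_mono: "justified M m c x v \<Longrightarrow> M \<subseteq> N \<Longrightarrow> justified N m c x v"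
  unfolding justified_def by (elim disj_forward ex_forward conj_forward) (blast | assumption)+

lemma justified_code_simps:
  "justified M m 0 x v \<longleftrightarrow> v = 0"
  "justified M m (Suc 0) x v \<longleftrightarrow> v = Suc x"
  "justified M m 2 x v \<longleftrightarrow> v = pfst x"
  "justified M m 3 x v \<longleftrightarrow> v = psnd x"
  "justified M m 4 x v \<longleftrightarrow> v = 0 \<or> v = 1 \<and> m = 1 \<and> (\<exists>u. claim 0 x x u \<in> M)"
  by (simp_all add: justified_def)

text \<open>The four kinds of compound programs have codes in different residue classes modulo
  4.\<close>

lemma code_class_simps:
  "(5 + 4 * a = 6 + 4 * b) = False" "(5 + 4 * a = 7 + 4 * b) = False"
  "(5 + 4 * a = 8 + 4 * b) = False" "(6 + 4 * a = 5 + 4 * b) = False"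
  "(6 + 4 * a = 7 + 4 * b) = False" "(6 + 4 * a = 8 + 4 * b) = False"
  "(7 + 4 * a = 5 + 4 * b) = False" "(7 + 4 * a = 6 + 4 * b) = False"
  "(7 + 4 * a = 8 + 4 * b) = False" "(8 + 4 * a = 5 + 4 * b) = False"
  "(8 + 4 * a = 6 + 4 * b) = False" "(8 + 4 * a = 7 + 4 * b) = False"
  for a b :: nat
  by presburger+

lemma justified_Pairing:
  "justified M m (5 + 4 * npair f g) x v \<longleftrightarrow>
     claim m f x (pfst v) \<in> M \<and> claim m g x (psnd v) \<in> M"
  unfolding justified_def code_class_simps by simp

lemma justified_Comp:
  "justified M m (6 + 4 * npair f g) x v \<longleftrightarrow> (\<exists>u. claim m g x u \<in> M \<and> claim m f u v \<in> M)"
  unfolding justified_def code_class_simps by simp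

lemma justified_PrimRec:
  "justified M m (7 + 4 * npair f g) x v \<longleftrightarrow>
     psnd x = 0 \<and> claim m f (pfst x) v \<in> M \<or>
     (\<exists>k u. psnd x = Suc k \<and> claim m (7 + 4 * npair f g) (npair (pfst x) k) u \<in> M \<and>
        claim m g (npair (pfst x) (npair k u)) v \<in> M)"
  unfolding justified_def code_class_simps by simp

lemma justified_Mu:
  "justified M m (8 + 4 * f) x v \<longleftrightarrow>
     claim m f (npair x v) 0 \<in> M \<and> (\<forall>y<v. \<exists>u. claim m f (npair x y) (Suc u) \<in> M)"
  unfolding justified_def code_class_simps by simp

lemmas justified_simps = justified_code_simps justified_Pairing justified_Comp
  justified_PrimRec justified_Mu

definition closed :: "nat set \<Rightarrow> bool" where
  "closed M \<longleftrightarrow> (\<forall>m c x v. claim m c x v \<in> M \<longrightarrow> justified M m c x v)"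

lemma closedD: "closed M \<Longrightarrow> claim m c x v \<in> M \<Longrightarrow> justified M m c x v"
  by (simp add: closed_def)

text \<open>Here 4 is the code of \<open>Query\<close>. The condition is co-enumerable: a false
  negative answer is exposed by a halting computation.\<close>

definition negatively_correct :: "nat set \<Rightarrow> bool" where
  "negatively_correct M \<longleftrightarrow> (\<forall>y. claim 1 4 y 0 \<in> M \<longrightarrow> y \<notin> halting_set)"

section \<open>Soundness of certificates\<close>

lemma run_Mu_eq_Some_iff:
  "run A (Mu f) x = Some v \<longleftrightarrow> run A f (npair x v) = Some 0 \<and>
     (\<forall>y<v. \<exists>u. run A f (npair x y) = Some (Suc u))"
proof -
  define hit where "hit n \<longleftrightarrow> run A f (npair x n) = Some 0 \<and>
    (\<forall>y<n. \<exists>u>0. run A f (npair x y) = Some u)" for n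
  have run: "run A (Mu f) x = (if \<exists>n. hit n then Some (LEAST n. hit n) else None)"
    by (simp add: hit_def Let_def)
  \<comment> \<open>Positivity of the values before a hit excludes an earlier hit, so any hit is the
    least one.\<close>
  have unique: "n \<le> k" if "hit n" "hit k" for n k
    using that unfolding hit_def by (metis linorder_not_le nat_less_le option.inject)
  have "run A (Mu f) x = Some v \<longleftrightarrow> hit v"
    unfolding run using unique by (auto intro: LeastI Least_equality)
  then show ?thesis unfolding hit_def gr0_conv_Suc by auto
qed

text \<open>Correct oracle answers are a hypothesis, so that mode 0 can be settled first and then
  used to validate the positive answers of mode 1.\<close>

lemma run_of_claim_step:
  assumes "closed M"
    and query: "\<And>x v. claim m 4 x v \<in> M \<Longrightarrow> v = (if x \<in> query_set m then 1 else 0)"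
    and "claim m (prog_encode p) x v \<in> M"
  shows "run (query_set m) p x = Some v"
  using assms(3)
proof (induction p arbitrary: x v)
  case Query
  then show ?case using query by simp
next
  case (Pairing f g)
  then have "justified M m (5 + 4 * npair (prog_encode f) (prog_encode g)) x v"
    by (auto dest: closedD[OF \<open>closed M\<close>])
  then show ?case by (auto simp: justified_simps dest!: Pairing.IH)
next
  case (Comp f g)
  then have "justified M m (6 + 4 * npair (prog_encode f) (prog_encode g)) x v"
    using \<open>closed M\<close> by (simp add: closed_def)
  then show ?case using Comp.IH by (auto simp: justified_simps)
next
  case (PrimRec f g)
  let ?c = "7 + 4 * npair (prog_encode f) (prog_encode g)"
  let ?rec = "\<lambda>y. rec_nat (run (query_set m) f y)
    (\<lambda>k r. Option.bind r (\<lambda>u. run (query_set m) g (npair y (npair k u))))"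
  \<comment> \<open>A \<open>PrimRec\<close> claim rests on a claim about the same code, so the
    induction on programs needs an inner one on the recursion argument.\<close>
  have "claim m ?c (npair y n) v \<in> M \<Longrightarrow> ?rec y n = Some v" for y n v
  proof (induction n arbitrary: v)
    case 0
    then have "justified M m ?c (npair y 0) v"
      using \<open>closed M\<close> by (simp add: closed_def)
    then show ?case by (simp add: justified_simps PrimRec.IH)
  next
    case (Suc n)
    from Suc.prems have "justified M m ?c (npair y (Suc n)) v"
      using \<open>closed M\<close> by (simp add: closed_def)
    then obtain u where "claim m ?c (npair y n) u \<in> M"
      and "claim m (prog_encode g) (npair y (npair n u)) v \<in> M"
      by (auto simp: justified_simps)
    then show ?case using Suc.IH PrimRec.IH(2) by simp
  qed
  from this[of "pfst x" "psnd x" v] PrimRec.prems show ?case by (simp add: case_prod_beta)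
next
  case (Mu f)
  then have "justified M m (8 + 4 * prog_encode f) x v"
    using \<open>closed M\<close> by (simp add: closed_def)
  then have hit: "run (query_set m) f (npair x v) = Some 0"
    and pos: "\<And>y. y < v \<Longrightarrow> \<exists>u. run (query_set m) f (npair x y) = Some (Suc u)"
    using Mu.IH by (auto simp: justified_simps)
  then show ?case by (simp only: run_Mu_eq_Some_iff) blast
qed (auto dest!: closedD[OF \<open>closed M\<close>] simp: justified_simps)

lemma run_of_claim_0:
  assumes "closed M" "claim 0 c x v \<in> M"
  shows "\<phi> c x = Some v"
proof -
  have "v = 0" if "claim 0 4 x v \<in> M" for x v
    using that assms(1) by (auto simp: closed_def dest!: spec) (auto simp: justified_simps)
  then have "run (query_set 0) (prog_decode c) x = Some v"
    using assms by (intro run_of_claim_step[of M]) (auto simp: query_set_def)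
  then show ?thesis by (simp add: \<phi>_def \<Phi>_def query_set_def)
qed

lemma run_of_claim_1:
  assumes "closed M" "negatively_correct M" "claim 1 c x v \<in> M"
  shows "\<Phi> halting_set c x = Some v"
proof -
  have "v = (if x \<in> query_set 1 then 1 else 0)" if "claim 1 4 x v \<in> M" for x v
  proof -
    have "justified M 1 4 x v" using that assms(1) by (simp add: closed_def)
    then consider "v = 0" | u where "v = 1" "claim 0 x x u \<in> M"
      by (auto simp: justified_simps)
    then show ?thesis
    proof cases
      case 1
      then show ?thesis using that assms(2) by (simp add: negatively_correct_def query_set_def)
    next
      case 2
      then have "x \<in> halting_set"
        using run_of_claim_0[OF assms(1)] by (auto simp: halting_set_def)
      with 2 show ?thesis by (simp add: query_set_def)
    qed
  qed
  then have "run (query_set 1) (prog_decode c) x = Some v"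
    using assms by (intro run_of_claim_step[of M]) auto
  then show ?thesis by (simp add: \<Phi>_def query_set_def)
qed

section \<open>Completeness: halting computations have finite certificates\<close>

definition certified :: "nat \<Rightarrow> bool" where
  "certified z \<longleftrightarrow> (\<exists>M. finite M \<and> closed M \<and> negatively_correct M \<and> z \<in> M)"

lemma certificate_of_finite:
  assumes "finite Z" "\<And>z. z \<in> Z \<Longrightarrow> certified z"
  shows "\<exists>M. finite M \<and> closed M \<and> negatively_correct M \<and> Z \<subseteq> M"
proof -
  obtain C where C: "\<And>z. z \<in> Z \<Longrightarrow>
      finite (C z) \<and> closed (C z) \<and> negatively_correct (C z) \<and> z \<in> C z"
    using assms(2) unfolding certified_def by metis
  have "closed (\<Union>z\<in>Z. C z)"
    unfolding closed_def
  proof (intro allI impI)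
    fix m c x v
    assume "claim m c x v \<in> (\<Union>z\<in>Z. C z)"
    then obtain z where z: "z \<in> Z" "claim m c x v \<in> C z" by blast
    then have "justified (C z) m c x v" using C unfolding closed_def by blast
    then show "justified (\<Union>z\<in>Z. C z) m c x v" by (rule justified_mono) (use z in blast)
  qed
  moreover have "negatively_correct (\<Union>z\<in>Z. C z)"
    using C unfolding negatively_correct_def by blast
  moreover have "finite (\<Union>z\<in>Z. C z)" "Z \<subseteq> (\<Union>z\<in>Z. C z)"
    using C assms(1) by blast+
  ultimately show ?thesis by blast
qed

text \<open>Adjoins one claim to a common certificate of its premises. The last hypothesis guards
  the one kind of claim that being justified leaves unchecked, a negative answer of the halting
  set.\<close>

lemma certifiedI:
  assumes "finite Z" "\<And>z. z \<in> Z \<Longrightarrow> certified z" "justified Z m c x v"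
    and "m = 1 \<Longrightarrow> c = 4 \<Longrightarrow> v = 0 \<Longrightarrow> x \<notin> halting_set"
  shows "certified (claim m c x v)"
proof -
  obtain M where M: "finite M" "closed M" "negatively_correct M" "Z \<subseteq> M"
    using certificate_of_finite[OF assms(1,2)] by blast
  let ?M = "insert (claim m c x v) M"
  have "justified ?M m c x v" using assms(3) by (rule justified_mono) (use M in blast)
  moreover have "justified ?M m' c' x' v'" if "claim m' c' x' v' \<in> M" for m' c' x' v'
    using M(2) that justified_mono[OF _ subset_insertI] by (simp add: closed_def)
  ultimately have "closed ?M" unfolding closed_def by auto
  moreover have "negatively_correct ?M"
    using M(3) assms(4) by (auto simp: negatively_correct_def)
  ultimately show ?thesis unfolding certified_def using M(1) by (intro exI[of _ ?M]) simp
qed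

lemma certified_of_run_step:
  assumes query: "\<And>y. y \<in> query_set m \<Longrightarrow> \<exists>u. certified (claim 0 y y u)"
    and "run (query_set m) p x = Some v"
  shows "certified (claim m (prog_encode p) x v)"
  using assms(2)
proof (induction p arbitrary: x v)
  case Query
  show ?case
  proof (cases "x \<in> query_set m")
    case True
    then obtain u where "certified (claim 0 x x u)" using query by blast
    moreover have "m = 1" "v = 1"
      using True Query by (simp_all add: query_set_def split: if_splits)
    ultimately show ?thesis
      by (intro certifiedI[of "{claim 0 x x u}"]) (auto simp: justified_simps)
  next
    case False
    then show ?thesis
      using Query by (intro certifiedI[of "{}"]) (auto simp: justified_simps query_set_def)
  qed
next
  case (Pairing f g)
  then obtain u1 u2 where u: "run (query_set m) f x = Some u1" "run (query_set m) g x = Some u2"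
      "v = npair u1 u2"
    by (auto simp: bind_eq_Some_conv)
  show ?case
    by (rule certifiedI[of "{claim m (prog_encode f) x u1, claim m (prog_encode g) x u2}"])
       (use u Pairing.IH in \<open>auto simp: justified_simps\<close>)
next
  case (Comp f g)
  then obtain u where u: "run (query_set m) g x = Some u" "run (query_set m) f u = Some v"
    by (auto simp: bind_eq_Some_conv)
  show ?case
    by (rule certifiedI[of "{claim m (prog_encode f) u v, claim m (prog_encode g) x u}"])
       (use u Comp.IH in \<open>auto simp: justified_simps\<close>)
next
  case (PrimRec f g)
  let ?c = "7 + 4 * npair (prog_encode f) (prog_encode g)"
  let ?rec = "\<lambda>y. rec_nat (run (query_set m) f y)
    (\<lambda>k r. Option.bind r (\<lambda>u. run (query_set m) g (npair y (npair k u))))"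
  have "?rec y n = Some v \<Longrightarrow> certified (claim m ?c (npair y n) v)" for y n v
  proof (induction n arbitrary: v)
    case 0
    then show ?case
      using PrimRec.IH(1)
      by (intro certifiedI[of "{claim m (prog_encode f) y v}"]) (auto simp: justified_simps)
  next
    case (Suc n)
    from Suc.prems obtain u where "?rec y n = Some u"
      "run (query_set m) g (npair y (npair n u)) = Some v"
      by (auto simp: bind_eq_Some_conv)
    then show ?case
      using Suc.IH PrimRec.IH(2)
      by (intro certifiedI[of "{claim m ?c (npair y n) u,
            claim m (prog_encode g) (npair y (npair n u)) v}"]) (auto simp: justified_simps)
  qed
  from this[of "pfst x" "psnd x" v] PrimRec.prems show ?case by (simp add: case_prod_beta)
next
  case (Mu f)
  then obtain U where hit: "run (query_set m) f (npair x v) = Some 0"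
    and U: "\<And>y. y < v \<Longrightarrow> run (query_set m) f (npair x y) = Some (Suc (U y))"
    unfolding run_Mu_eq_Some_iff by metis
  \<comment> \<open>A successful search uses only finitely many values: the zero at \<open>v\<close>
    and the positive ones before it.\<close>
  let ?Z = "insert (claim m (prog_encode f) (npair x v) 0)
    ((\<lambda>y. claim m (prog_encode f) (npair x y) (Suc (U y))) ` {..<v})"
  have "certified z" if "z \<in> ?Z" for z
    using that Mu.IH[OF hit] Mu.IH[OF U] by blast
  moreover have "justified ?Z m (prog_encode (Mu f)) x v"
    unfolding prog_encode.simps justified_Mu by blast
  moreover have "prog_encode (Mu f) \<noteq> 4" by simp
  ultimately show ?case by (intro certifiedI[of ?Z]) blast+
qed (rule certifiedI[of "{}"]; simp add: justified_simps)+

lemma certified_of_run_0: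
  assumes "\<phi> c x = Some v"
  shows "certified (claim 0 c x v)"
  using certified_of_run_step[of 0 "prog_decode c" x v] assms
  by (simp add: query_set_def \<phi>_def \<Phi>_def)

lemma certified_of_run_1:
  assumes "\<Phi> halting_set c x = Some v"
  shows "certified (claim 1 c x v)"
proof -
  have "\<exists>u. certified (claim 0 y y u)" if "y \<in> query_set 1" for y
    using that certified_of_run_0 by (auto simp: query_set_def halting_set_def)
  from certified_of_run_step[where m = 1 and p = "prog_decode c" and x = x and v = v, OF this] assms
  show ?thesis by (simp add: query_set_def \<Phi>_def)
qed

section \<open>Decidability of closedness\<close>

lemma justified_set_decode_iff:
  "justified (set_decode w) m c x v \<longleftrightarrow>
     c = 0 \<and> v = 0 \<or> c = 1 \<and> v = Suc x \<or> c = 2 \<and> v = pfst x \<or> c = 3 \<and> v = psnd x \<or>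
     c = 4 \<and> (v = 0 \<or> v = 1 \<and> m = 1 \<and> (\<exists>u<w. claim 0 x x u \<in> set_decode w)) \<or>
     (\<exists>f<c. \<exists>g<c. c = 5 + 4 * npair f g \<and>
        claim m f x (pfst v) \<in> set_decode w \<and> claim m g x (psnd v) \<in> set_decode w) \<or>
     (\<exists>f<c. \<exists>g<c. c = 6 + 4 * npair f g \<and>
        (\<exists>u<w. claim m g x u \<in> set_decode w \<and> claim m f u v \<in> set_decode w)) \<or>
     (\<exists>f<c. \<exists>g<c. c = 7 + 4 * npair f g \<and>
        (psnd x = 0 \<and> claim m f (pfst x) v \<in> set_decode w \<or>
         (\<exists>k<psnd x. \<exists>u<w. psnd x = Suc k \<and> claim m c (npair (pfst x) k) u \<in> set_decode w \<and>
           claim m g (npair (pfst x) (npair k u)) v \<in> set_decode w))) \<or>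
     (\<exists>f<c. c = 8 + 4 * f \<and> claim m f (npair x v) 0 \<in> set_decode w \<and>
        (\<forall>y<v. \<exists>u<w. claim m f (npair x y) (Suc u) \<in> set_decode w))"
proof -
  \<comment> \<open>Subprograms have smaller codes, and \<open>claim_less\<close> bounds the
    components of claims in a coded set. So every existential quantifier can be bounded.\<close>
  have code: "f < a + 4 * npair f g \<and> g < a + 4 * npair f g" if "0 < a" for a f g
    using le_prod_encode_1[of f g] le_prod_encode_2[of g f] that by linarith
  have 5: "(\<exists>f g. c = 5 + 4 * npair f g \<and> R f g) \<longleftrightarrow>
      (\<exists>f<c. \<exists>g<c. c = 5 + 4 * npair f g \<and> R f g)" for R
    using code[of 5] by auto
  have 6: "(\<exists>f g. c = 6 + 4 * npair f g \<and> R f g) \<longleftrightarrow>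
      (\<exists>f<c. \<exists>g<c. c = 6 + 4 * npair f g \<and> R f g)" for R
    using code[of 6] by auto
  have 7: "(\<exists>f g. c = 7 + 4 * npair f g \<and> R f g) \<longleftrightarrow>
      (\<exists>f<c. \<exists>g<c. c = 7 + 4 * npair f g \<and> R f g)" for R
    using code[of 7] by auto
  have 8: "(\<exists>f. c = 8 + 4 * f \<and> R f) \<longleftrightarrow> (\<exists>f<c. c = 8 + 4 * f \<and> R f)" for R
    by auto
  have query: "(\<exists>u. claim 0 x x u \<in> set_decode w) \<longleftrightarrow> (\<exists>u<w. claim 0 x x u \<in> set_decode w)"
    using claim_less(4) by blast
  have comp: "(\<exists>u. claim m g x u \<in> set_decode w \<and> R u) \<longleftrightarrow>
      (\<exists>u<w. claim m g x u \<in> set_decode w \<and> R u)" for g R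
    using claim_less(4) by blast
  have rec: "(\<exists>k u. psnd x = Suc k \<and> claim m c (npair (pfst x) k) u \<in> set_decode w \<and> R k u) \<longleftrightarrow>
      (\<exists>k<psnd x. \<exists>u<w. psnd x = Suc k \<and> claim m c (npair (pfst x) k) u \<in> set_decode w \<and> R k u)"
    for R
    using claim_less(4) by (metis lessI)
  have mu: "(\<exists>u. claim m f (npair x y) (Suc u) \<in> set_decode w) \<longleftrightarrow>
      (\<exists>u<w. claim m f (npair x y) (Suc u) \<in> set_decode w)" for f y
    using claim_less(4) Suc_lessD by blast
  show ?thesis unfolding justified_def 5 6 7 8 query comp rec mu by (rule refl)
qed

lemma recursive_pred_justified:
  assumes "recursive_fun w" "recursive_fun m" "recursive_fun c" "recursive_fun x" "recursive_fun v"
  shows "recursive_pred (\<lambda>z. justified (set_decode (w z)) (m z) (c z) (x z) (v z))"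
  unfolding justified_set_decode_iff
  by (intro recursive_intros assms assms[THEN recursive_fun_comp])

lemma recursive_pred_closed [recursive_intros]:
  assumes "recursive_fun w"
  shows "recursive_pred (\<lambda>z. closed (set_decode (w z)))"
proof -
  \<comment> \<open>Every number is a claim, by repeated unpairing; one bounded quantifier therefore
    ranges over all quadruples.\<close>
  have "closed (set_decode w) \<longleftrightarrow> (\<forall>z<w. z \<in> set_decode w \<longrightarrow> justified (set_decode w)
      (pfst z) (pfst (psnd z)) (pfst (psnd (psnd z))) (psnd (psnd (psnd z))))" (is "_ \<longleftrightarrow> ?R") for w
  proof
    assume "closed (set_decode w)"
    then show ?R unfolding closed_def claim_def by (metis prod.collapse prod_decode_inverse)
  next
    assume R: ?R
    show "closed (set_decode w)"
      unfolding closed_def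
    proof (intro allI impI)
      fix m c x v
      assume *: "claim m c x v \<in> set_decode w"
      from R * less_of_mem_set_decode[OF *] show "justified (set_decode w) m c x v"
        by (auto simp: claim_def)
    qed
  qed
  note iff = this
  show ?thesis unfolding iff
    by (intro recursive_intros recursive_pred_justified assms assms[THEN recursive_fun_comp])
qed

section \<open>The diagonal coloring\<close>

text \<open>
  Read with \<^term>\<open>part = pfst\<close> or \<^term>\<open>part = psnd\<close>: the certificate \<open>w\<close> shows that the program
  \<open>k\<close>, on input \<open>e\<close>, returns an index of a decomposition in which \<open>0\<close> is on the blue path
  (on the red path).
\<close>

definition shows_zero :: "(nat \<Rightarrow> nat) \<Rightarrow> nat \<Rightarrow> nat \<Rightarrow> nat \<Rightarrow> bool" where
  "shows_zero part k e w \<longleftrightarrow>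
     (\<exists>d n. claim 0 k e d \<in> set_decode w \<and> claim 1 (part d) n 0 \<in> set_decode w)"

definition genuine :: "nat \<Rightarrow> nat \<Rightarrow> nat \<Rightarrow> bool" where
  "genuine k e w \<longleftrightarrow> closed (set_decode w) \<and> negatively_correct (set_decode w) \<and>
     (shows_zero pfst k e w \<or> shows_zero psnd k e w)"

text \<open>A decidable approximation to \<open>genuine\<close> at stage \<open>s\<close>: a
  negative answer about \<open>y\<close> is refuted by a closed set with code at most
  \<open>s\<close> that claims a value of program \<open>y\<close> on input
  \<open>y\<close>.\<close>

definition viable :: "nat \<Rightarrow> nat \<Rightarrow> nat \<Rightarrow> nat \<Rightarrow> bool" where
  "viable k e s w \<longleftrightarrow> w \<le> s \<and> closed (set_decode w) \<and>
     (shows_zero pfst k e w \<or> shows_zero psnd k e w) \<and>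
     (\<forall>t<Suc s. \<forall>y<w. claim 1 4 y 0 \<in> set_decode w \<longrightarrow>
        \<not> (closed (set_decode t) \<and> (\<exists>u<t. claim 0 y y u \<in> set_decode t)))"

text \<open>A relation, because a stage may have no viable candidate.\<close>

definition chosen :: "nat \<Rightarrow> nat \<Rightarrow> nat \<Rightarrow> nat \<Rightarrow> bool" where
  "chosen k e s w \<longleftrightarrow> viable k e s w \<and> (\<forall>w'<w. \<not> viable k e s w')"

text \<open>The inner equivalence merges the cases of a blue and a red \<open>K\<close>. If no
  candidate is chosen at \<open>s\<close>, the pair is red by default.\<close>

definition blue_pair :: "nat \<Rightarrow> nat \<Rightarrow> nat \<Rightarrow> nat \<Rightarrow> bool" where
  "blue_pair k e z s \<longleftrightarrow>
     (\<exists>w<Suc s. chosen k e s w \<and> (chosen k e z w \<longleftrightarrow> shows_zero pfst k e w))"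

lemma recursive_pred_shows_zero:
  assumes "\<And>f. recursive_fun f \<Longrightarrow> recursive_fun (\<lambda>z. part (f z))"
    and "recursive_fun e" "recursive_fun w"
  shows "recursive_pred (\<lambda>z. shows_zero part k (e z) (w z))"
proof -
  have "shows_zero part k e w \<longleftrightarrow> (\<exists>d<w. \<exists>n<w.
      claim 0 k e d \<in> set_decode w \<and> claim 1 (part d) n 0 \<in> set_decode w)" for e w
    unfolding shows_zero_def using claim_less(3,4) by blast
  note iff = this
  show ?thesis unfolding iff
    by (intro recursive_intros assms(1) assms(2-) assms(2-)[THEN recursive_fun_comp])
qed

lemma recursive_pred_viable:
  assumes "recursive_fun e" "recursive_fun s" "recursive_fun w"
  shows "recursive_pred (\<lambda>z. viable k (e z) (s z) (w z))"
  unfolding viable_def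
  by (intro recursive_intros recursive_pred_shows_zero assms assms[THEN recursive_fun_comp])

lemma recursive_pred_chosen:
  assumes "recursive_fun e" "recursive_fun s" "recursive_fun w"
  shows "recursive_pred (\<lambda>z. chosen k (e z) (s z) (w z))"
  unfolding chosen_def
  by (intro recursive_intros recursive_pred_viable assms assms[THEN recursive_fun_comp])

lemma recursive_pred_blue_pair:
  assumes "recursive_fun e" "recursive_fun x" "recursive_fun s"
  shows "recursive_pred (\<lambda>z. blue_pair k (e z) (x z) (s z))"
  unfolding blue_pair_def
  by (intro recursive_intros recursive_pred_iff recursive_pred_chosen recursive_pred_shows_zero
      assms assms[THEN recursive_fun_comp])

section \<open>Convergence of the chosen candidate\<close>

lemma viable_of_genuine:
  assumes "genuine k e w" "w \<le> s"
  shows "viable k e s w"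
proof -
  \<comment> \<open>By soundness a refuting set would come from a real halting computation,
    contradicting the correct negative answer.\<close>
  have "\<not> (closed (set_decode t) \<and> (\<exists>u<t. claim 0 y y u \<in> set_decode t))"
    if "claim 1 4 y 0 \<in> set_decode w" for t y
    using that assms(1) run_of_claim_0
    by (fastforce simp: genuine_def negatively_correct_def halting_set_def)
  then show ?thesis using assms by (simp add: genuine_def viable_def)
qed

text \<open>In the main case some negative answer concerns a member of the halting set. Completeness
  yields a finite \<open>M\<close> exposing it, and the refutation holds from stage
  \<open>set_encode M\<close> on.\<close>

lemma eventually_not_viable:
  assumes "\<not> genuine k e w"
  shows "\<forall>\<^sub>F s in sequentially. \<not> viable k e s w"
proof (cases "closed (set_decode w) \<and> (shows_zero pfst k e w \<or> shows_zero psnd k e w)")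
  case True
  then obtain y where y: "claim 1 4 y 0 \<in> set_decode w" "y \<in> halting_set"
    using assms by (auto simp: genuine_def negatively_correct_def)
  then obtain u where "\<phi> y y = Some u" by (auto simp: halting_set_def)
  then obtain M where M: "finite M" "closed M" "claim 0 y y u \<in> M"
    using certified_of_run_0 unfolding certified_def by blast
  have "\<not> viable k e s w" if "set_encode M \<le> s" for s
  proof -
    have "claim 0 y y u \<in> set_decode (set_encode M)" using M by simp
    then have "u < set_encode M" by (rule claim_less)
    then show ?thesis
      using M y(1) claim_less(3)[OF y(1)] that unfolding viable_def
      by (metis less_Suc_eq_le set_encode_inverse)
  qed
  then show ?thesis unfolding eventually_sequentially by blast
qed (simp add: viable_def)

lemma viable_antimono:
  assumes "viable k e s w" "z \<le> s" "w \<le> z"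
  shows "viable k e z w"
  using assms unfolding viable_def by auto

text \<open>Smaller candidates had already entered the competition at stage \<open>z\<close> and
  were not viable then; by \<open>viable_antimono\<close> they never recover.\<close>

lemma chosen_mono:
  assumes "genuine k e w" "chosen k e z w" "z \<le> s"
  shows "chosen k e s w"
proof -
  have "w \<le> z" using assms(2) by (simp add: chosen_def viable_def)
  then have "viable k e s w" using viable_of_genuine assms(1,3) by simp
  moreover have "\<not> viable k e s w'" if "w' < w" for w'
    using that assms(2,3) \<open>w \<le> z\<close> viable_antimono[of k e s w' z] by (auto simp: chosen_def)
  ultimately show ?thesis by (simp add: chosen_def)
qed

text \<open>The only candidate at stage 0 codes the empty set, which contains no claims. This keeps
  the point 0 outside the cofinite set \<open>F\<close>.\<close>

lemma not_chosen_0: "\<not> chosen k e 0 w"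
  by (auto simp: chosen_def viable_def shows_zero_def)

lemma blue_pair_iff:
  assumes "chosen k e s w"
  shows "blue_pair k e z s \<longleftrightarrow> (chosen k e z w \<longleftrightarrow> shows_zero pfst k e w)"
proof -
  have "w' = w" if "chosen k e s w'" for w'
    using that assms unfolding chosen_def by (metis linorder_neqE_nat)
  moreover have "w < Suc s" using assms by (simp add: chosen_def viable_def)
  ultimately show ?thesis unfolding blue_pair_def using assms by blast
qed

section \<open>Two paths against a cofinite set\<close>

lemma no_separated_decomposition:
  assumes P: "mono_path c K P" and Q: "mono_path c L Q" and "K \<noteq> L"
    and cover: "ran P \<union> ran Q = UNIV" and a: "a \<in> ran P" "a \<notin> F" and fin: "finite (- F)"
    and across: "\<And>z s. z \<notin> F \<Longrightarrow> s \<in> F \<Longrightarrow> c {z, s} = L"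
    and inside: "\<And>z s. z \<in> F \<Longrightarrow> s \<in> F \<Longrightarrow> z \<noteq> s \<Longrightarrow> c {z, s} = K"
  shows False
proof -
  have domP: "n \<in> dom P \<Longrightarrow> m < n \<Longrightarrow> m \<in> dom P" for m n
    using P by (auto simp: mono_path_def initial_segment_def)
  have domQ: "n \<in> dom Q \<Longrightarrow> m < n \<Longrightarrow> m \<in> dom Q" for m n
    using Q by (auto simp: mono_path_def initial_segment_def)
  have edgeP: "Suc n \<in> dom P \<Longrightarrow> c {the (P n), the (P (Suc n))} = K" for n
    using P by (simp add: mono_path_def)
  have edgeQ: "Suc n \<in> dom Q \<Longrightarrow> c {the (Q n), the (Q (Suc n))} = L" for n
    using Q by (simp add: mono_path_def)
  have injQ: "m = n" if "m \<in> dom Q" "n \<in> dom Q" "the (Q m) = the (Q n)" for m n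
    using Q that unfolding mono_path_def inj_on_def by (metis domD option.sel)
  \<comment> \<open>A step between \<open>F\<close> and its complement would have color
    \<open>L\<close>, so \<open>P\<close> never changes sides.\<close>
  have same_side: "n \<in> dom P \<Longrightarrow> the (P n) \<in> F \<longleftrightarrow> the (P 0) \<in> F" for n
  proof (induction n)
    case (Suc n)
    then have "the (P n) \<in> F \<longleftrightarrow> the (P 0) \<in> F" using domP by blast
    then show ?case
      using edgeP[OF Suc.prems] across \<open>K \<noteq> L\<close> by (metis insert_commute)
  qed simp
  obtain i where "P i = Some a" using a(1) by (auto simp: ran_def)
  then have "the (P 0) \<notin> F" using same_side[of i] a(2) by auto
  then have "ran P \<inter> F = {}" using same_side by (force simp: ran_def)
  then have FQ: "F \<subseteq> ran Q" using cover by blast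
  define D where "D = {n \<in> dom Q. the (Q n) \<in> F}"
  have "F \<subseteq> (\<lambda>n. the (Q n)) ` D" using FQ by (force simp: ran_def D_def)
  moreover have "infinite F" using fin finite_compl by blast
  ultimately have "infinite D" using finite_surj by blast
  \<comment> \<open>\<open>Q\<close> visits \<open>F\<close> at arbitrarily late positions, so it
    cannot end at any of them.\<close>
  have next_dom: "Suc n \<in> dom Q" if "n \<in> D" for n
  proof -
    obtain m where "m \<in> D" "n < m" using \<open>infinite D\<close> by (meson finite_nat_set_iff_bounded_le not_le)
    then show ?thesis using domQ[of m "Suc n"] by (cases "m = Suc n") (auto simp: D_def)
  qed
  have "the (Q (Suc n)) \<in> - F" if "n \<in> D" for n
  proof
    assume "the (Q (Suc n)) \<in> F"
    moreover have "the (Q n) \<noteq> the (Q (Suc n))"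
      using injQ[of n "Suc n"] next_dom[OF that] that by (auto simp: D_def)
    ultimately show False
      using inside edgeQ[OF next_dom[OF that]] that \<open>K \<noteq> L\<close> by (auto simp: D_def)
  qed
  \<comment> \<open>Taking successors along \<open>Q\<close> injects the infinite \<open>D\<close>
    into the finite complement of \<open>F\<close>.\<close>
  moreover have "inj_on (\<lambda>n. the (Q (Suc n))) D"
    by (rule inj_onI) (use injQ next_dom in blast)
  ultimately have "finite D" using fin by (meson finite_imageD finite_subset image_subsetI)
  with \<open>infinite D\<close> show False by contradiction
qed

theorem theorem7:
  shows "\<not> (\<exists>f :: nat \<Rightarrow> nat option. partial_computable f \<and>
           (\<forall>(e :: nat) (c :: coloring). computable_coloring c \<and> coloring_index e c \<longrightarrow>
              (\<exists>d P. f e = Some d \<and> delta2_path_decomposition c P \<and> decomposition_index d P)))"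
proof
  assume "\<exists>f :: nat \<Rightarrow> nat option. partial_computable f \<and>
           (\<forall>(e :: nat) (c :: coloring). computable_coloring c \<and> coloring_index e c \<longrightarrow>
              (\<exists>d P. f e = Some d \<and> delta2_path_decomposition c P \<and> decomposition_index d P))"
  then obtain k where k: "\<And>e c. coloring_index e c \<Longrightarrow>
      \<exists>d P. \<phi> k e = Some d \<and> delta2_path_decomposition c P \<and> decomposition_index d P"
    unfolding partial_computable_def computable_coloring_def by blast
  \<comment> \<open>The program outputs color codes and \<open>RED\<close> has code 1, hence the
    negation. The index \<open>k\<close> of the supposed function is a constant; the recursion
    theorem supplies \<open>e\<close>.\<close>
  have "recursive_fun (\<lambda>q. of_bool (\<not> blue_pair k (pfst q) (pfst (psnd q)) (psnd (psnd q))))"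
    unfolding recursive_pred_def[symmetric]
    by (intro recursive_intros recursive_pred_blue_pair)
  then obtain e where e: "\<And>x. \<phi> e x = Some (of_bool (\<not> blue_pair k e (pfst x) (psnd x)))"
    using recursion_theorem by force
  \<comment> \<open>Colorings act on unordered pairs; \<open>Min\<close> and \<open>Max\<close>
    restore the order on which \<open>blue_pair\<close> depends.\<close>
  define c :: coloring where "c A = (if blue_pair k e (Min A) (Max A) then BLUE else RED)" for A
  have c: "c {z, s} = (if blue_pair k e z s then BLUE else RED)" if "z < s" for z s
    using that by (simp add: c_def)
  then have "coloring_index e c" by (simp add: coloring_index_def e)
  then obtain d Pb Pr where d: "\<phi> k e = Some d" and dec: "delta2_path_decomposition c (Pb, Pr)"
    and "decomposition_index d (Pb, Pr)"
    using k by (metis surj_pair)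
  then have Pb: "\<Phi> halting_set (pfst d) = Pb" and Pr: "\<Phi> halting_set (psnd d) = Pr"
    by (auto simp: decomposition_index_def)
  have path: "mono_path c BLUE Pb" "mono_path c RED Pr" and cover: "ran Pb \<union> ran Pr = UNIV"
    using dec by (auto simp: delta2_path_decomposition_def)
  have "\<exists>w. genuine k e w"
  proof -
    have "0 \<in> ran Pb \<union> ran Pr" using cover by simp
    then obtain i n where n: "\<Phi> halting_set i n = Some 0" "i = pfst d \<or> i = psnd d"
      using Pb Pr by (auto simp: ran_def)
    \<comment> \<open>A single certificate covers the computation of \<open>d\<close> and the one
      that puts 0 on the path with index \<open>i\<close>.\<close>
    obtain M where M: "finite M" "closed M" "negatively_correct M"
        "{claim 0 k e d, claim 1 i n 0} \<subseteq> M"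
      using certificate_of_finite[of "{claim 0 k e d, claim 1 i n 0}"]
        certified_of_run_0[OF d] certified_of_run_1[OF n(1)] by auto
    then have "genuine k e (set_encode M)"
      using n(2) by (auto simp: genuine_def shows_zero_def)
    then show ?thesis ..
  qed
  then obtain w where w: "genuine k e w" and least: "\<And>w'. w' < w \<Longrightarrow> \<not> genuine k e w'"
    by (metis exists_least_iff)
  have on_path: "0 \<in> ran (\<Phi> halting_set (part d))" if shown: "shows_zero part k e w" for part
  proof -
    obtain d' n where "claim 0 k e d' \<in> set_decode w" "claim 1 (part d') n 0 \<in> set_decode w"
      using shown unfolding shows_zero_def by blast
    \<comment> \<open>By soundness the index \<open>d'\<close> named in the certificate is the
      actual value \<open>d\<close>.\<close>
    then have "\<phi> k e = Some d'" "\<Phi> halting_set (part d') n = Some 0"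
      using w run_of_claim_0 run_of_claim_1 unfolding genuine_def by blast+
    then show ?thesis using d by (auto simp: ran_def)
  qed
  define F where "F = {s. chosen k e s w}"
  have up: "z \<in> F \<Longrightarrow> z \<le> s \<Longrightarrow> s \<in> F" for z s
    using chosen_mono[OF w] by (simp add: F_def)
  have "0 \<notin> F" by (simp add: F_def not_chosen_0)
  \<comment> \<open>Only finitely many candidates lie below \<open>w\<close>, and none is genuine,
    so from some stage on none is viable.\<close>
  have "\<forall>\<^sub>F s in sequentially. \<forall>w'\<in>{..<w}. \<not> viable k e s w'"
    by (intro eventually_ball_finite) (simp_all add: eventually_not_viable least)
  then have "\<forall>\<^sub>F s in sequentially. s \<in> F"
    using eventually_ge_at_top[of w]
    by eventually_elim (auto simp: F_def chosen_def viable_of_genuine[OF w])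
  then obtain T where "\<And>s. T \<le> s \<Longrightarrow> s \<in> F" unfolding eventually_sequentially by blast
  then have "- F \<subseteq> {..<T}" by (metis ComplD lessThan_iff not_le subsetI)
  then have fin: "finite (- F)" by (rule finite_subset) simp
  have color: "c {z, s} = (if z \<in> F \<longleftrightarrow> shows_zero pfst k e w then BLUE else RED)"
    if "z < s" "s \<in> F" for z s
    using that blue_pair_iff[of k e s w z] by (simp add: c F_def)
  have across: "c {z, s} = (if shows_zero pfst k e w then RED else BLUE)" if "z \<notin> F" "s \<in> F" for z s
  proof -
    \<comment> \<open>\<open>F\<close> is upward closed, so points outside \<open>F\<close> lie
      below all points of \<open>F\<close>, and the larger point \<open>s\<close> decides the
      color.\<close>
    have "z < s" using that up by (metis not_le)
    then show ?thesis using color that by simp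
  qed
  have inside: "c {z, s} = (if shows_zero pfst k e w then BLUE else RED)"
    if "z \<in> F" "s \<in> F" "z \<noteq> s" for z s
    using that color[of z s] color[of s z] by (cases z s rule: linorder_cases) (simp_all add: insert_commute)
  show False
  proof (cases "shows_zero pfst k e w")
    case True
    then have "0 \<in> ran Pb" using on_path Pb by blast
    from no_separated_decomposition[OF path _ cover this \<open>0 \<notin> F\<close> fin]
    show False using across inside True by simp
  next
    case False
    \<comment> \<open>A genuine \<open>w\<close> places 0 on one of the paths, which here must be
      the red one.\<close>
    then have "0 \<in> ran Pr" using on_path Pr w unfolding genuine_def by blast
    from no_separated_decomposition[OF path(2,1) _ _ this \<open>0 \<notin> F\<close> fin]
    show False using across inside False cover by (simp add: Un_commute)
  qed
qed

end
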